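(* Let $p$ be an odd prime, let $g$ be a primitive element of $\mathbb{F}_{p^2}^*$, and let $\langle g^{p-1}\rangle$ denote the set of $(p-1)$-th powers in $\mathbb{F}_{p^2}^*$. Let $u,v\in\mathbb{F}_{p^2}^*$ be such that the polynomial $2vX^5+uX^4+u^pX+2v^p\in\mathbb{F}_{p^2}[X]$ has no root in $\langle g^{p-1}\rangle$. Then, for any $h\in\{0,\dots,p-1\}$, the function \[G_h\colon\mathbb{F}_{p^2}\to\mathbb{F}_{p^2},\quad X\mapsto u\cdot X^{2p-1}+v\cdot X^{3p-2}+X^{h(p+1)}\] is GAPN and of algebraic degree $\max\{p,2h\}$.
   Context: $\mathbb{F}_{p^n}$ denotes the finite field with $p^n$ elements and $\mathbb{F}_{p^n}^*$ its multiplicative group; a primitive element of $\mathbb{F}_{p^2}^*$ is a generator of this cyclic group. By convention $X^0$ is the constant function $1$. A function $G\colon\mathbb{F}_{p^n}\to\mathbb{F}_{p^n}$ is GAPN (generalized almost perfect nonlinear) if for all $a\in\mathbb{F}_{p^n}^*$ and $b\in\mathbb{F}_{p^n}$ the equation $\sum_{i\in\mathbb{F}_p}G(X+ia)=b$ has at most $p$ solutions $X\in\mathbb{F}_{p^n}$. For a non-negative integer $m$ with base-$p$ representation $m=\sum_{i\ge 0}h_ip^i$, put $d_p(m)=\sum_{i\ge0}h_i$. The algebraic degree of a nonzero function $G(X)=\sum_{m=0}^{p^n-1}a_mX^m$ (the unique such representation of degree at most $p^n-1$, with $a_m\in\mathbb{F}_{p^n}$) is the maximum of $d_p(m)$ over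 all $m\in\{0,\dots,p^n-1\}$ with $a_m\ne0$. *)

theory Defs
  imports "HOL-Library.Cardinality" "HOL-Computational_Algebra.Computational_Algebra"
begin

text \<open>
  The field with \<open>p ^ n\<close> elements is rendered as a type \<open>'a :: finite_field\<close> with
  \<open>CARD('a) = p ^ n\<close>. Its characteristic is then \<open>p\<close>, so the notions below refer to
  \<open>CHAR('a)\<close> instead of carrying \<open>p\<close> as an extra parameter.
\<close>

lemma CHAR_eq_of_CARD_prime_power:
  assumes "prime p" and "CARD('a :: finite_field) = p ^ n"
  shows "CHAR('a) = p"
proof -
  have "prime CHAR('a)"
    by (rule prime_CHAR_semidom) (simp add: finite_imp_CHAR_pos)
  moreover have "CHAR('a) dvd p ^ n"
  proof -
    have "(\<Sum>x\<in>UNIV. x + 1) = (\<Sum>x\<in>UNIV. x :: 'a)"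
      by (rule sum.reindex_bij_witness[of _ "\<lambda>x. x - 1" "\<lambda>x. x + 1"]) auto
    then have "(of_nat CARD('a) :: 'a) = 0"
      by (simp add: sum.distrib)
    then show ?thesis
      using assms(2) by (simp add: of_nat_eq_0_iff_char_dvd del: of_nat_power)
  qed
  ultimately show ?thesis
    using assms(1) by (metis prime_dvd_power primes_dvd_imp_eq)
qed

definition cyclic_subgroup :: "'a :: field \<Rightarrow> 'a set" where
  "cyclic_subgroup g = range (\<lambda>k::int. g powi k)"

definition primitive_element :: "'a :: finite_field \<Rightarrow> bool" where
  "primitive_element g \<longleftrightarrow> g \<noteq> 0 \<and> cyclic_subgroup g = UNIV - {0}"

lemma cyclic_subgroup_power_primitive_element:
  assumes "primitive_element g"
  shows "cyclic_subgroup (g ^ k) = (\<lambda>y. y ^ k) ` (UNIV - {0})"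
proof -
  have "(g ^ k) powi j = (g powi j) ^ k" for j
    by (simp add: power_int_def power_mult [symmetric] mult.commute power_inverse)
  then have "cyclic_subgroup (g ^ k) = (\<lambda>y. y ^ k) ` cyclic_subgroup g"
    by (simp add: cyclic_subgroup_def image_image)
  then show ?thesis
    using assms by (simp add: primitive_element_def)
qed

text \<open>The summation index ranges over the prime subfield, which is \<open>range of_nat\<close>.\<close>

definition GAPN :: "('a :: finite_field \<Rightarrow> 'a) \<Rightarrow> bool" where
  "GAPN G \<longleftrightarrow>
     (\<forall>a b. a \<noteq> 0 \<longrightarrow>
        card {X. (\<Sum>i\<in>range of_nat. G (X + i * a)) = b} \<le> CHAR('a))"

text \<open>
  The upper limit \<open>m\<close> exhausts the base-\<open>p\<close> digits of \<open>m\<close>, because \<open>m < p ^ m\<close> for \<open>p \<ge> 2\<close>.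
\<close>

definition digit_sum :: "nat \<Rightarrow> nat \<Rightarrow> nat" where
  "digit_sum p m = (\<Sum>i\<le>m. m div p ^ i mod p)"

lemma digit_sum_less [simp]: "m < p \<Longrightarrow> digit_sum p m = m"
proof -
  assume "m < p"
  have "digit_sum p m = (\<Sum>i\<in>{0}. m div p ^ i mod p)"
    unfolding digit_sum_def
  proof (rule sum.mono_neutral_right)
    show "\<forall>i\<in>{..m} - {0}. m div p ^ i mod p = 0"
    proof
      fix i assume "i \<in> {..m} - {0}"
      then have "m < p ^ i"
        using \<open>m < p\<close> self_le_power[of p i] by auto
      then show "m div p ^ i mod p = 0" by simp
    qed
  qed auto
  then show ?thesis using \<open>m < p\<close> by simp
qed

definition reduced_poly :: "('a :: finite_field \<Rightarrow> 'a) \<Rightarrow> 'a poly" where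
  "reduced_poly G = (THE P. degree P < CARD('a) \<and> (\<forall>x. poly P x = G x))"

lemma ex1_reduced_poly:
  fixes G :: "'a :: finite_field \<Rightarrow> 'a"
  shows "\<exists>!P. degree P < CARD('a) \<and> (\<forall>x. poly P x = G x)"
proof (rule ex_ex1I)
  define L where "L a = (\<Prod>b\<in>UNIV - {a}. [:-b, 1:])" for a :: 'a
  define P where "P = (\<Sum>a\<in>UNIV. smult (G a / poly (L a) a) (L a))"
  have L0: "poly (L a) x = 0 \<longleftrightarrow> x \<noteq> a" for a x
    by (auto simp: L_def poly_prod)
  have "degree (L a) = CARD('a) - 1" for a
    unfolding L_def by (subst degree_prod_eq_sum_degree) (auto simp: card_Diff_singleton)
  then have "degree P \<le> CARD('a) - 1"
    unfolding P_def by (intro degree_sum_le) auto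
  moreover have "0 < CARD('a)" by simp
  ultimately have "degree P < CARD('a)" by linarith
  moreover have "poly P x = G x" for x
  proof -
    have "poly P x = (\<Sum>a\<in>UNIV. if a = x then G x else 0)"
      unfolding P_def poly_sum using L0 by (intro sum.cong) auto
    then show ?thesis by simp
  qed
  ultimately show "\<exists>P. degree P < CARD('a) \<and> (\<forall>x. poly P x = G x)" by blast
next
  fix P Q :: "'a poly"
  assume "degree P < CARD('a) \<and> (\<forall>x. poly P x = G x)"
    and "degree Q < CARD('a) \<and> (\<forall>x. poly Q x = G x)"
  then show "P = Q"
    by (intro poly_eqI_degree[where A = UNIV]) auto
qed

text \<open>Meaningful for nonzero \<open>G\<close> only: \<open>Max {}\<close> is unspecified.\<close>

definition algebraic_degree :: "('a :: finite_field \<Rightarrow> 'a) \<Rightarrow> nat" where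
  "algebraic_degree G = Max (digit_sum CHAR('a) ` {m. coeff (reduced_poly G) m \<noteq> 0})"

end

theory Submission
  imports Defs "HOL-Number_Theory.Cong"
begin

text \<open>
  Write \<open>F\<^sub>p\<close> for the prime subfield and \<open>X = aY\<close>. With \<open>Z = Y + i\<close> and \<open>e = Y\<^sup>p - Y\<close> one has
  \<open>Z\<^sup>p = Z + e\<close> for every \<open>i \<in> F\<^sub>p\<close>, so that the first two summands of \<open>G\<^sub>h\<close> become
  \<open>Z\<^sup>p\<^sup>-\<^sup>1 (Z + e)\<close> and \<open>Z\<^sup>p\<^sup>-\<^sup>2 (Z + e)\<^sup>2\<close> up to constants; power sums over \<open>F\<^sub>p\<close> turn the sum over
  \<open>i\<close> into \<open>c (Y - Y\<^sup>p)\<close>. The third summand is a power of the norm, so it contributes an element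
  of \<open>F\<^sub>p\<close>. Comparing two solutions and conjugating shows that \<open>(c + c\<^sup>p) (d - d\<^sup>p) = 0\<close> for the
  difference \<open>d\<close> of their \<open>Y\<close>. Up to a nonzero factor, \<open>c + c\<^sup>p\<close> is the value of the given
  quintic at \<open>a\<^sup>p\<^sup>-\<^sup>1\<close>; hence \<open>d \<in> F\<^sub>p\<close>, which leaves at most \<open>p\<close> solutions.
\<close>

section \<open>The prime subfield and its power sums\<close>

lemma range_of_nat_CHAR:
  "range (of_nat :: nat \<Rightarrow> 'a :: finite_field) = of_nat ` {..<CHAR('a)}"
proof -
  have "(of_nat n :: 'a) = of_nat (n mod CHAR('a))" for n
    by (simp add: of_nat_eq_iff_cong_CHAR cong_def)
  then have "(of_nat n :: 'a) \<in> of_nat ` {..<CHAR('a)}" for n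
    by (rule image_eqI) simp
  then show ?thesis by blast
qed

lemma card_range_of_nat: "card (range (of_nat :: nat \<Rightarrow> 'a :: finite_field)) = CHAR('a)"
proof -
  have "inj_on (of_nat :: nat \<Rightarrow> 'a) {..<CHAR('a)}"
    by (rule inj_onI) (simp add: of_nat_eq_iff_cong_CHAR cong_def)
  then show ?thesis by (simp add: range_of_nat_CHAR card_image)
qed

lemma of_nat_power_CHAR: "(of_nat n :: 'a :: finite_field) ^ CHAR('a) = of_nat n"
  by (induction n) (simp_all add: freshmans_dream power_0_left)

text \<open>The prime subfield already supplies \<open>CHAR('a)\<close> roots of X^p - X, and a
  nonzero polynomial of degree at most p has no further ones.\<close>

lemma frobenius_fixed_points: "{x :: 'a :: finite_field. x ^ CHAR('a) = x} = range of_nat"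
proof -
  define P :: "'a poly" where "P = monom 1 (CHAR('a)) - monom 1 1"
  have "CHAR('a) > 1" by (rule prime_gt_1_nat) simp
  then have "coeff P (CHAR('a)) = 1" by (simp add: P_def)
  then have "P \<noteq> 0" by auto
  have "degree P \<le> CHAR('a)"
    unfolding P_def using \<open>CHAR('a) > 1\<close>
    by (intro degree_diff_le) (auto intro: order.trans[OF degree_monom_le])
  have "range of_nat \<subseteq> {x :: 'a. x ^ CHAR('a) = x}"
    by (auto simp: of_nat_power_CHAR)
  moreover have "card {x :: 'a. x ^ CHAR('a) = x} \<le> CHAR('a)"
    using card_poly_roots_bound[OF \<open>P \<noteq> 0\<close>] \<open>degree P \<le> CHAR('a)\<close>
    by (simp add: P_def poly_monom)
  ultimately show ?thesis
    by (intro card_seteq[symmetric]) (simp_all add: card_range_of_nat)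
qed

text \<open>For k > 0, multiplication by a nonzero c in the prime subfield permutes it and so
  multiplies the sum by c^k without changing it. As X^k - 1 has at most k < p - 1 roots, some c has
  c^k \<noteq> 1.\<close>

lemma sum_power_prime_subfield:
  assumes "k < CHAR('a) - 1"
  shows "(\<Sum>i\<in>range of_nat. i ^ k) = (0 :: 'a :: finite_field)"
proof (cases "k = 0")
  \<comment> \<open>Here every term is 1, including 0^0, and p ones add up to 0.\<close>
  case True
  then show ?thesis by (simp add: card_range_of_nat)
next
  case False
  define F :: "'a set" where "F = range of_nat"
  define P :: "'a poly" where "P = monom 1 k - 1"
  have "coeff P k = 1" using False by (simp add: P_def)
  then have "P \<noteq> 0" by auto
  have "degree P \<le> k"
    unfolding P_def by (intro degree_diff_le) (auto simp: degree_monom_le)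
  have "0 \<in> F" unfolding F_def by (rule range_eqI[of _ _ 0]) simp
  have "\<exists>c\<in>F - {0}. c ^ k \<noteq> 1"
  proof (rule ccontr)
    assume "\<not> (\<exists>c\<in>F - {0}. c ^ k \<noteq> 1)"
    then have "F - {0} \<subseteq> {x. poly P x = 0}" by (auto simp: P_def poly_monom)
    then have "card (F - {0}) \<le> card {x. poly P x = 0}" by (intro card_mono) simp_all
    also have "\<dots> \<le> k"
      using card_poly_roots_bound[OF \<open>P \<noteq> 0\<close>] \<open>degree P \<le> k\<close> by simp
    finally show False
      using assms \<open>0 \<in> F\<close> by (simp add: F_def card_range_of_nat)
  qed
  then obtain c where c: "c \<in> F" "c \<noteq> 0" "c ^ k \<noteq> 1" by blast
  \<comment> \<open>As the fixed points of Frobenius, \<open>F\<close> is visibly closed under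
    multiplication and division by c.\<close>
  have "x ^ CHAR('a) = x \<longleftrightarrow> x \<in> F" for x
    using frobenius_fixed_points unfolding F_def by blast
  then have "(\<Sum>i\<in>F. (c * i) ^ k) = (\<Sum>i\<in>F. i ^ k)"
    using c by (intro sum.reindex_bij_witness[of _ "\<lambda>y. y / c" "\<lambda>y. c * y"])
      (auto simp flip: \<open>\<And>x. x ^ CHAR('a) = x \<longleftrightarrow> x \<in> F\<close> simp: power_mult_distrib power_divide)
  then have "c ^ k * (\<Sum>i\<in>F. i ^ k) = (\<Sum>i\<in>F. i ^ k)"
    by (simp add: power_mult_distrib sum_distrib_left)
  then show ?thesis using c(3) unfolding F_def by simp
qed

lemma sum_power_prime_subfield_minus_1:
  "(\<Sum>i\<in>range of_nat. i ^ (CHAR('a) - 1)) = (-1 :: 'a :: finite_field)"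
proof -
  define F :: "'a set" where "F = range of_nat"
  have "CHAR('a) > 1" by (rule prime_gt_1_nat) simp
  have "0 \<in> F" unfolding F_def by (rule range_eqI[of _ _ 0]) simp
  have "i ^ (CHAR('a) - 1) = (if i = 0 then 0 else 1)" if "i \<in> F" for i
  proof -
    have "i ^ Suc (CHAR('a) - 1) = i"
      using that by (auto simp: F_def of_nat_power_CHAR simp del: power_Suc)
    then have "i * i ^ (CHAR('a) - 1) = i" by (simp only: power_Suc)
    then show ?thesis using \<open>CHAR('a) > 1\<close> by auto
  qed
  then have "(\<Sum>i\<in>F. i ^ (CHAR('a) - 1)) = (\<Sum>i\<in>F. if i = 0 then 0 else 1)"
    by (intro sum.cong) auto
  also have "\<dots> = (\<Sum>i\<in>F - {0}. 1)"
    by (intro sum.mono_neutral_cong_right) auto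
  also have "\<dots> = of_nat (CHAR('a) - 1)"
    using \<open>0 \<in> F\<close> by (simp add: F_def card_range_of_nat)
  also have "\<dots> = -1" by (simp add: of_nat_diff Suc_leI)
  finally show ?thesis by (simp add: F_def)
qed

text \<open>In the binomial expansion only the power sum of exponent p - 1 survives, and it occurs
  only for k = p - 1 and j = 0; hence the shift has no effect.\<close>

lemma sum_shifted_power_prime_subfield:
  fixes y :: "'a :: finite_field"
  assumes "k \<le> CHAR('a) - 1"
  shows "(\<Sum>i\<in>range of_nat. (y + i) ^ k) = (if k = CHAR('a) - 1 then -1 else 0)"
proof -
  have "(\<Sum>i\<in>range of_nat. (y + i) ^ k) =
      (\<Sum>j\<le>k. of_nat (k choose j) * y ^ j * (\<Sum>i\<in>range of_nat. i ^ (k - j)))"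
    by (simp only: binomial_ring sum_distrib_left) (rule sum.swap)
  also have "\<dots> = (\<Sum>j\<le>k. if j = 0 then if k = CHAR('a) - 1 then -1 else 0 else 0)"
  proof (rule sum.cong)
    fix j assume "j \<in> {..k}"
    show "of_nat (k choose j) * y ^ j * (\<Sum>i\<in>range of_nat. i ^ (k - j)) =
        (if j = 0 then if k = CHAR('a) - 1 then -1 else 0 else 0)"
    proof (cases "j = 0 \<and> k = CHAR('a) - 1")
      case True
      then show ?thesis using sum_power_prime_subfield_minus_1[where 'a = 'a] by simp
    next
      case False
      then have "k - j < CHAR('a) - 1" using assms \<open>j \<in> {..k}\<close> by auto
      from sum_power_prime_subfield[OF this] show ?thesis using False by auto
    qed
  qed simp
  finally show ?thesis by simp
qed

section \<open>Sums of the monomials along the prime subfield\<close>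

lemma sum_monomials_prime_subfield:
  fixes y :: "'a :: finite_field"
  assumes "odd CHAR('a)"
  defines "p \<equiv> CHAR('a)"
  shows "(\<Sum>i\<in>range of_nat. (y + i) ^ (2 * p - 1)) = y - y ^ p"
    and "(\<Sum>i\<in>range of_nat. (y + i) ^ (3 * p - 2)) = 2 * (y - y ^ p)"
proof -
  define F :: "'a set" where "F = range of_nat"
  define e where "e = y ^ p - y"
  have "prime p" by (simp add: p_def)
  then have "p > 2" using assms prime_ge_2_nat[of p] by (cases "p = 2") auto
  then have exps: "Suc (p - 1) = p" "Suc (p - 2) = p - 1" "p - 1 + p = 2 * p - 1"
      "p - 2 + p * 2 = 3 * p - 2" "p - 2 \<noteq> p - 1"
    by simp_all
  have frob: "(y + i) ^ p = (y + i) + e" if "i \<in> F" for i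
    using that by (auto simp: F_def p_def e_def freshmans_dream of_nat_power_CHAR)
  \<comment> \<open>Exponent 1 lies below p - 1 because p > 2.\<close>
  have "(\<Sum>i\<in>F. i ^ 1) = 0"
    unfolding F_def using \<open>p > 2\<close> by (intro sum_power_prime_subfield) (simp add: p_def)
  moreover have "(of_nat (card F) :: 'a) = 0" by (simp add: F_def card_range_of_nat)
  ultimately have s1: "(\<Sum>i\<in>F. (y + i) ^ p) = 0"
    using frob by (simp add: sum.distrib)
  have s2: "(\<Sum>i\<in>F. (y + i) ^ (p - 1)) = -1"
    unfolding F_def p_def by (subst sum_shifted_power_prime_subfield) simp_all
  have s3: "(\<Sum>i\<in>F. (y + i) ^ (p - 2)) = 0"
    using exps(5) unfolding F_def p_def by (subst sum_shifted_power_prime_subfield) simp_all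
  have "(y + i) ^ (2 * p - 1) = (y + i) ^ p + e * (y + i) ^ (p - 1)" if "i \<in> F" for i
  proof -
    have "(y + i) ^ (2 * p - 1) = (y + i) ^ (p - 1) * (y + i) ^ p"
      by (simp only: power_add [symmetric] exps)
    also have "\<dots> = (y + i) ^ Suc (p - 1) + e * (y + i) ^ (p - 1)"
      using frob[OF that] by (simp add: algebra_simps)
    finally show ?thesis by (simp only: exps)
  qed
  then have "(\<Sum>i\<in>F. (y + i) ^ (2 * p - 1)) = - e"
    by (simp add: sum.distrib s1 s2 del: One_nat_def flip: sum_distrib_left)
  then show "(\<Sum>i\<in>range of_nat. (y + i) ^ (2 * p - 1)) = y - y ^ p"
    by (simp add: F_def e_def)
  \<comment> \<open>The exponent splits as (p - 2) + 2p. Squaring Z + e gives the cross term 2eZ,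
    the only source of Z^(p-1) and hence of the factor 2 in the result.\<close>
  have "(y + i) ^ (3 * p - 2) =
      (y + i) ^ p + 2 * e * (y + i) ^ (p - 1) + e ^ 2 * (y + i) ^ (p - 2)" if "i \<in> F" for i
  proof -
    have "(y + i) ^ (3 * p - 2) = (y + i) ^ (p - 2) * ((y + i) ^ p) ^ 2"
      by (simp only: power_add [symmetric] power_mult [symmetric] exps)
    also have "\<dots> = (y + i) ^ Suc (Suc (p - 2)) + 2 * e * (y + i) ^ Suc (p - 2)
        + e ^ 2 * (y + i) ^ (p - 2)"
      using frob[OF that] by (simp add: power2_eq_square algebra_simps)
    finally show ?thesis by (simp only: exps)
  qed
  then have "(\<Sum>i\<in>F. (y + i) ^ (3 * p - 2)) = - (2 * e)"
    by (simp add: sum.distrib s1 s2 s3 del: One_nat_def flip: sum_distrib_left)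
  then show "(\<Sum>i\<in>range of_nat. (y + i) ^ (3 * p - 2)) = 2 * (y - y ^ p)"
    by (simp add: F_def e_def)
qed

section \<open>Digit sums and reduced polynomials\<close>

lemma digit_sum_two_digits:
  assumes "a < p" "b < p"
  shows "digit_sum p (b * p + a) = a + b"
proof (cases "b = 0")
  case True
  then show ?thesis using assms by simp
next
  case False
  define m where "m = b * p + a"
  \<comment> \<open>This puts the index 1 inside the summation range \<open>{..m}\<close> of
    \<open>digit_sum\<close>.\<close>
  have "m \<ge> 1" using False assms by (cases b) (auto simp: m_def)
  have "digit_sum p m = (\<Sum>i\<in>{0, 1}. m div p ^ i mod p)"
    unfolding digit_sum_def
  proof (rule sum.mono_neutral_right)
    show "\<forall>i\<in>{..m} - {0, 1}. m div p ^ i mod p = 0"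
    proof
      fix i assume "i \<in> {..m} - {0, 1}"
      then have "2 \<le> i" by auto
      have "m < Suc b * p" using assms by (simp add: m_def)
      also have "\<dots> \<le> p * p" using assms by (intro mult_right_mono) auto
      also have "\<dots> = p ^ 2" by (simp add: power2_eq_square)
      also have "\<dots> \<le> p ^ i" using \<open>2 \<le> i\<close> assms by (intro power_increasing) auto
      finally show "m div p ^ i mod p = 0" by simp
    qed
  qed (use \<open>m \<ge> 1\<close> in auto)
  then show ?thesis using assms by (simp add: m_def)
qed

lemma reduced_poly_eqI:
  fixes P :: "'a :: finite_field poly"
  assumes "degree P < CARD('a)" and "\<And>x. poly P x = G x"
  shows "reduced_poly G = P"
  unfolding reduced_poly_def
  by (rule the1_equality[OF ex1_reduced_poly]) (use assms in blast)

section \<open>The trinomial\<close>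

text \<open>The three exponents have base-p digits (1, p - 1), (2, p - 2) and (h, h). They are
  distinct and below p^2, so the trinomial is its own reduced polynomial and no coefficients
  merge.\<close>

lemma algebraic_degree_trinomial:
  fixes u v :: "'a :: finite_field"
  assumes "prime p" "odd p" and card: "CARD('a) = p ^ 2" and "u \<noteq> 0" "v \<noteq> 0" "h < p"
  shows "algebraic_degree (\<lambda>X :: 'a. u * X ^ (2 * p - 1) + v * X ^ (3 * p - 2) + X ^ (h * (p + 1)))
    = max p (2 * h)"
    (is "algebraic_degree ?G = _")
proof -
  have char: "CHAR('a) = p"
    using assms by (intro CHAR_eq_of_CARD_prime_power)
  have "p \<ge> 3" using assms prime_ge_2_nat[of p] by (cases "p = 2") auto
  have digits: "2 * p - 1 = 1 * p + (p - 1)" "3 * p - 2 = 2 * p + (p - 2)" "h * (p + 1) = h * p + h"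
    using \<open>p \<ge> 3\<close> by simp_all
  have ds: "digit_sum p (2 * p - 1) = p" "digit_sum p (3 * p - 2) = p"
      "digit_sum p (h * (p + 1)) = 2 * h"
    unfolding digits using \<open>p \<ge> 3\<close> \<open>h < p\<close> by (subst digit_sum_two_digits; simp)+
  have less: "b * p + a < p ^ 2" if "a < p" "b < p" for a b
  proof -
    have "b * p + a < Suc b * p" using that by simp
    also have "\<dots> \<le> p * p" using that by (intro mult_right_mono) auto
    finally show ?thesis by (simp add: power2_eq_square)
  qed
  have lt: "2 * p - 1 < p ^ 2" "3 * p - 2 < p ^ 2" "h * (p + 1) < p ^ 2"
    unfolding digits using \<open>p \<ge> 3\<close> \<open>h < p\<close> by (intro less; simp)+
  have mod: "(2 * p - 1) mod p = p - 1" "(3 * p - 2) mod p = p - 2" "(h * (p + 1)) mod p = h"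
    and div: "(2 * p - 1) div p = 1" "(3 * p - 2) div p = 2" "(h * (p + 1)) div p = h"
    unfolding digits using \<open>p \<ge> 3\<close> \<open>h < p\<close> by (subst mod_mult_self3 div_mult_self3; simp)+
  have ne: "2 * p - 1 \<noteq> 3 * p - 2" "2 * p - 1 \<noteq> h * (p + 1)" "3 * p - 2 \<noteq> h * (p + 1)"
  proof -
    show "2 * p - 1 \<noteq> 3 * p - 2" using \<open>p \<ge> 3\<close> by simp
    \<comment> \<open>Equal digits would give h = 1 = p - 1, hence p = 2.\<close>
    show "2 * p - 1 \<noteq> h * (p + 1)" using mod(1,3) div(1,3) \<open>p \<ge> 3\<close> by (auto simp del: One_nat_def)
    show "3 * p - 2 \<noteq> h * (p + 1)"
    proof
      assume "3 * p - 2 = h * (p + 1)"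
      then have "p - 2 = h" "2 = h" using mod(2,3) div(2,3) by simp_all
      then have "p = 4" by simp
      with \<open>odd p\<close> show False by simp
    qed
  qed
  define P :: "'a poly" where
    "P = monom u (2 * p - 1) + monom v (3 * p - 2) + monom 1 (h * (p + 1))"
  have "degree P \<le> p ^ 2 - 1"
    unfolding P_def using lt by (intro degree_add_le) (auto intro: order.trans[OF degree_monom_le])
  moreover have "0 < p ^ 2" using \<open>p \<ge> 3\<close> by simp
  ultimately have "degree P < CARD('a)" unfolding card by linarith
  then have "reduced_poly ?G = P"
    by (rule reduced_poly_eqI) (simp add: P_def poly_monom)
  moreover have "{m. coeff P m \<noteq> 0} = {2 * p - 1, 3 * p - 2, h * (p + 1)}"
    using assms(4,5) ne by (auto simp: P_def coeff_monom split: if_splits)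
  ultimately show ?thesis
    by (simp add: algebraic_degree_def char ds del: One_nat_def)
qed

text \<open>The root condition ranges over all (p-1)-th powers because the direction
  \<open>a\<close> enters the quintic through \<open>a ^ (p - 1)\<close>.\<close>

lemma GAPN_trinomial:
  fixes u v :: "'a :: finite_field"
  assumes "prime p" "odd p" and card: "CARD('a) = p ^ 2"
    and no_root: "\<And>a. a \<noteq> 0 \<Longrightarrow> poly [:2 * v ^ p, u ^ p, 0, 0, u, 2 * v:] (a ^ (p - 1)) \<noteq> 0"
  shows "GAPN (\<lambda>X :: 'a. u * X ^ (2 * p - 1) + v * X ^ (3 * p - 2) + X ^ (h * (p + 1)))"
    (is "GAPN ?G")
  unfolding GAPN_def
proof (intro allI impI)
  fix a b :: 'a
  assume "a \<noteq> 0"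
  define F :: "'a set" where "F = range of_nat"
  define D where "D X = (\<Sum>i\<in>F. ?G (X + i * a))" for X
  define H where "H X = (\<Sum>i\<in>F. (X + i * a) ^ (h * (p + 1)))" for X
  define c where "c = u * a ^ (2 * p - 1) + 2 * v * a ^ (3 * p - 2)"
  have char: "CHAR('a) = p"
    using assms by (intro CHAR_eq_of_CARD_prime_power)
  have "p \<ge> 3" using assms prime_ge_2_nat[of p] by (cases "p = 2") auto
  have add: "(x + y) ^ p = x ^ p + y ^ p" for x y :: 'a
    using \<open>prime p\<close> by (simp add: freshmans_dream char)
  have diff: "(x - y) ^ p = x ^ p - y ^ p" for x y :: 'a
    using add[of "x - y" y] by (simp add: eq_diff_eq)
  have conj: "(x ^ p) ^ p = x" for x :: 'a
    using finite_field_power_card_eq_same[of x] card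
    by (simp add: power2_eq_square flip: power_mult)
  \<comment> \<open>x^(p+1) is the norm to the prime subfield, so its powers, and sums of them, are
    fixed by conjugation.\<close>
  have H_fixed: "H X ^ p = H X" for X
  proof -
    have "((x ^ (p + 1)) ^ p) = x ^ (p + 1)" for x :: 'a
      using conj[of x] by (simp add: power_mult_distrib mult.commute)
    then have "((x ^ (h * (p + 1))) ^ p) = x ^ (h * (p + 1))" for x :: 'a
      by (metis (no_types) mult.commute power_mult)
    then show ?thesis
      unfolding H_def using \<open>prime p\<close> by (simp add: freshmans_dream_sum char)
  qed
  have D_eq: "D (a * y) = c * (y - y ^ p) + H (a * y)" for y
  proof -
    have scale: "(\<Sum>i\<in>F. (a * y + i * a) ^ k) = a ^ k * (\<Sum>i\<in>F. (y + i) ^ k)" for k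
      by (simp add: sum_distrib_left algebra_simps flip: power_mult_distrib)
    have "D (a * y) = u * (\<Sum>i\<in>F. (a * y + i * a) ^ (2 * p - 1))
        + v * (\<Sum>i\<in>F. (a * y + i * a) ^ (3 * p - 2)) + H (a * y)"
      by (simp add: D_def H_def sum.distrib sum_distrib_left)
    also have "\<dots> = u * (a ^ (2 * p - 1) * (y - y ^ p))
        + v * (a ^ (3 * p - 2) * (2 * (y - y ^ p))) + H (a * y)"
      unfolding scale
      using sum_monomials_prime_subfield[of y] \<open>odd p\<close> by (simp add: F_def char)
    finally show ?thesis by (simp add: c_def algebra_simps)
  qed
  have c_ne: "c + c ^ p \<noteq> 0"
  proof -
    \<comment> \<open>Conjugation swaps \<open>a\<close> and \<open>s\<close>, so \<open>c\<close>
      and its conjugate become rational expressions in these two, and \<open>a ^ (p - 1)\<close>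
      becomes s / a.\<close>
    define s where "s = a ^ p"
    have "s \<noteq> 0" using \<open>a \<noteq> 0\<close> by (simp add: s_def)
    have sp: "s ^ p = a" by (simp add: s_def conj)
    have exps: "p = (p - 1) + 1" "p * 2 = (2 * p - 1) + 1" "p * 3 = (3 * p - 2) + 2"
      using \<open>p \<ge> 3\<close> by simp_all
    have "a ^ p = a ^ (p - 1) * a"
      by (subst exps) (simp only: power_add power_one_right)
    then have t: "a ^ (p - 1) = s / a" using \<open>a \<noteq> 0\<close> by (simp add: s_def)
    have "s ^ 2 = a ^ (2 * p - 1) * a"
      unfolding s_def power_mult [symmetric] by (subst exps) (simp only: power_add power_one_right)
    then have e1: "a ^ (2 * p - 1) = s ^ 2 / a" using \<open>a \<noteq> 0\<close> by simp
    have "s ^ 3 = a ^ (3 * p - 2) * a ^ 2"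
      unfolding s_def power_mult [symmetric] by (subst exps) (simp only: power_add)
    then have e2: "a ^ (3 * p - 2) = s ^ 3 / a ^ 2" using \<open>a \<noteq> 0\<close> by simp
    have "(2 :: 'a) ^ p = 2"
      using of_nat_power_CHAR[of 2, where 'a = 'a] by (simp add: char)
    moreover have "(x ^ k) ^ p = (x ^ p) ^ k" for x :: 'a and k
      by (simp add: mult.commute flip: power_mult)
    ultimately have cp: "c ^ p = u ^ p * (a ^ 2 / s) + 2 * v ^ p * (a ^ 3 / s ^ 2)"
      unfolding c_def e1 e2
      by (simp add: add power_mult_distrib power_divide sp flip: s_def)
    \<comment> \<open>The prefactor is read off from the constant term: \<open>2 * v ^ p\<close>
      occurs in \<open>c ^ p\<close> with the factor a^3 / s^2.\<close>
    have "c + c ^ p = a ^ 3 / s ^ 2 * poly [:2 * v ^ p, u ^ p, 0, 0, u, 2 * v:] (s / a)"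
      unfolding cp unfolding c_def e1 e2 using \<open>a \<noteq> 0\<close> \<open>s \<noteq> 0\<close>
      by (simp add: field_simps power2_eq_square power3_eq_cube)
    then show ?thesis
      using no_root[OF \<open>a \<noteq> 0\<close>] \<open>a \<noteq> 0\<close> \<open>s \<noteq> 0\<close> by (simp only: t) simp
  qed
  have F_diff: "y - z \<in> F" if eq: "D (a * y) = D (a * z)" for y z
  proof -
    define d where "d = y - z"
    have 1: "c * (d - d ^ p) = H (a * z) - H (a * y)"
      using eq by (simp add: D_eq d_def diff algebra_simps)
    \<comment> \<open>Conjugation fixes the right-hand side but negates d - d^p; adding the two
      equations cancels the \<open>H\<close> terms.\<close>
    then have "c ^ p * (d - d ^ p) ^ p = H (a * z) - H (a * y)"
      by (metis H_fixed diff power_mult_distrib)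
    moreover have "(d - d ^ p) ^ p = - (d - d ^ p)" by (simp add: diff conj)
    ultimately have "- (c ^ p * (d - d ^ p)) = H (a * z) - H (a * y)"
      by (simp only: mult_minus_right)
    then have "c ^ p * (d - d ^ p) = - (H (a * z) - H (a * y))"
      by (simp only: minus_equation_iff)
    with 1 have "(c + c ^ p) * (d - d ^ p) = 0"
      by (simp only: distrib_right add.right_inverse)
    then have "d ^ p = d" using c_ne by simp
    then show ?thesis
      using frobenius_fixed_points[where 'a = 'a] by (auto simp: F_def d_def char)
  qed
  have "card {X. D X = b} \<le> p"
  proof (cases "{X. D X = b} = {}")
    case False
    then obtain x where x: "D x = b" by blast
    \<comment> \<open>All solutions lie on the line through one solution x in direction
      \<open>a\<close> over the prime subfield, which has p points.\<close>
    have "{X. D X = b} \<subseteq> (\<lambda>i. x + i * a) ` F"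
    proof
      fix X assume "X \<in> {X. D X = b}"
      then have "D (a * (X / a)) = D (a * (x / a))" using x \<open>a \<noteq> 0\<close> by simp
      then have "X / a - x / a \<in> F" by (rule F_diff)
      moreover have "X = x + (X / a - x / a) * a" using \<open>a \<noteq> 0\<close> by (simp add: field_simps)
      ultimately show "X \<in> (\<lambda>i. x + i * a) ` F" by blast
    qed
    then have "card {X. D X = b} \<le> card F" by (intro surj_card_le) simp_all
    then show ?thesis by (simp add: F_def card_range_of_nat char)
  qed simp
  then show "card {X. (\<Sum>i\<in>range of_nat. ?G (X + i * a)) = b} \<le> CHAR('a)"
    by (simp only: D_def F_def char)
qed

theorem theorem2:
  fixes p h :: nat and g u v :: "'a :: finite_field"
  assumes "prime p" and "odd p"
    and "CARD('a) = p ^ 2"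
    and "primitive_element g"
    and "u \<noteq> 0" and "v \<noteq> 0"
    and "\<forall>x \<in> cyclic_subgroup (g ^ (p - 1)).
           poly [:2 * v ^ p, u ^ p, 0, 0, u, 2 * v:] x \<noteq> 0"
    and "h \<in> {0..p - 1}"
  defines "G \<equiv> \<lambda>X :: 'a. u * X ^ (2 * p - 1) + v * X ^ (3 * p - 2) + X ^ (h * (p + 1))"
  shows "GAPN G \<and> algebraic_degree G = max p (2 * h)"
proof
  \<comment> \<open>Primitivity of \<open>g\<close> makes the subgroup generated by
    \<open>g ^ (p - 1)\<close> the set of all (p-1)-th powers of nonzero elements.\<close>
  have "a ^ (p - 1) \<in> cyclic_subgroup (g ^ (p - 1))" if "a \<noteq> 0" for a
    using that assms(4) by (simp add: cyclic_subgroup_power_primitive_element)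
  then show "GAPN G"
    unfolding G_def using assms(1-3,7) by (intro GAPN_trinomial) blast+
  have "h < p" using assms(8) prime_gt_0_nat[OF assms(1)] by auto
  then show "algebraic_degree G = max p (2 * h)"
    unfolding G_def using assms(1-3,5,6) by (intro algebraic_degree_trinomial)
qed

end
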